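(* Let $n$ be a positive integer and let $L$ be a lattice with $|L|=n$. Then: (1) if $|\mathrm{Con}(L)|=2^{n-1}$, then $\mathrm{Con}(L)\cong \mathcal{L}_2^{n-1}$; (2) if $|\mathrm{Con}(L)|=2^{n-2}$, then $n\geq 4$ and $\mathrm{Con}(L)\cong \mathcal{L}_2^{n-2}$; (3) if $|\mathrm{Con}(L)|=5\cdot 2^{n-5}$, then $n\geq 5$ and $\mathrm{Con}(L)\cong \mathcal{L}_2^{n-5}\times(\mathcal{L}_2\dotplus \mathcal{L}_2^2)$; (4) if $|\mathrm{Con}(L)|=2^{n-3}$, then $n\geq 6$ and $\mathrm{Con}(L)\cong \mathcal{L}_2^{n-3}$.
   Context: For a lattice $L$, $\mathrm{Con}(L)$ denotes the lattice of congruences of $L$, ordered by inclusion, and $\cong$ denotes lattice isomorphism. Powers of $2$ with possibly negative exponents are rational numbers. $\mathcal{L}_2$ is the two-element chain, and for an integer $s\geq 0$, $\mathcal{L}_2^s$ is its $s$-th direct power, i.e. the Boolean lattice with $2^s$ elements ($\mathcal{L}_2^0$ is the one-element lattice). Ordinal sum: for a lattice $A$ with greatest element $1_A$ and a lattice $B$ with least element $0_B$, $A\dotplus B$ is the lattice obtained by placing $B$ above $A$ and identifying $1_A$ with $0_B$; that is, with $c=1_A=0_B$ the only common element, the underlying set is the disjoint union of $A\setminus\{c\}$, $\{c\}$ and $B\setminus\{c\}$, and the order is $\leq_A\cup\leq_B\cup\{(x,y)\mid x\in A,\ y\in B\}$. Thus $\mathcal{L}_2\dotplus\mathcal{L}_2^2$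 is the five-element lattice obtained from the four-element Boolean lattice by adding a new least element. *)

theory Defs
  imports Complex_Main "HOL-Algebra.Lattice"
begin

text \<open>Lattices are the carrier-based ones of HOL-Algebra. In all structures built below the
  equality component is \<open>(=)\<close>, as the locale \<open>lattice\<close> demands.\<close>

definition lattice_congruence :: "('a, 'm) gorder_scheme \<Rightarrow> ('a \<times> 'a) set \<Rightarrow> bool" where
  "lattice_congruence L \<theta> \<longleftrightarrow>
     equiv (carrier L) \<theta> \<and>
     (\<forall>a b c d. (a, b) \<in> \<theta> \<longrightarrow> (c, d) \<in> \<theta> \<longrightarrow>
        (a \<squnion>\<^bsub>L\<^esub> c, b \<squnion>\<^bsub>L\<^esub> d) \<in> \<theta> \<and> (a \<sqinter>\<^bsub>L\<^esub> c, b \<sqinter>\<^bsub>L\<^esub> d) \<in> \<theta>)"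

definition Con :: "('a, 'm) gorder_scheme \<Rightarrow> ('a \<times> 'a) set gorder" where
  "Con L = \<lparr>carrier = {\<theta>. lattice_congruence L \<theta>}, eq = (=), le = (\<subseteq>)\<rparr>"

text \<open>The predicates \<open>join_pres\<close> and \<open>meet_pres\<close> include that both structures are lattices, so
  \<open>A \<cong>\<^sub>l B\<close> does too.\<close>

definition lattice_iso :: "('a, 'm) gorder_scheme \<Rightarrow> ('b, 'k) gorder_scheme \<Rightarrow> ('a \<Rightarrow> 'b) \<Rightarrow> bool" where
  "lattice_iso A B h \<longleftrightarrow> bij_betw h (carrier A) (carrier B) \<and> join_pres A B h \<and> meet_pres A B h"

definition lattice_isomorphic ::
    "('a, 'm) gorder_scheme \<Rightarrow> ('b, 'k) gorder_scheme \<Rightarrow> bool" (infix \<open>\<cong>\<^sub>l\<close> 50) where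
  "A \<cong>\<^sub>l B \<longleftrightarrow> (\<exists>h. lattice_iso A B h)"

text \<open>The two-element chain is \<open>bool\<close> with \<open>False < True\<close>.\<close>

definition chain2 :: "bool gorder" (\<open>\<L>\<^sub>2\<close>) where
  "\<L>\<^sub>2 = \<lparr>carrier = UNIV, eq = (=), le = (\<le>)\<rparr>"

definition lattice_power ::
    "('a, 'm) gorder_scheme \<Rightarrow> nat \<Rightarrow> (nat \<Rightarrow> 'a) gorder" (infixr \<open>[^]\<^sub>l\<close> 80) where
  "A [^]\<^sub>l s = \<lparr>carrier = {..<s} \<rightarrow>\<^sub>E carrier A, eq = (=),
                le = (\<lambda>f g. \<forall>i<s. f i \<sqsubseteq>\<^bsub>A\<^esub> g i)\<rparr>"

definition lattice_prod ::
    "('a, 'm) gorder_scheme \<Rightarrow> ('b, 'k) gorder_scheme \<Rightarrow> ('a \<times> 'b) gorder" (infixr \<open>\<times>\<^sub>l\<close> 70) where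
  "A \<times>\<^sub>l B = \<lparr>carrier = carrier A \<times> carrier B, eq = (=),
              le = (\<lambda>p q. fst p \<sqsubseteq>\<^bsub>A\<^esub> fst q \<and> snd p \<sqsubseteq>\<^bsub>B\<^esub> snd q)\<rparr>"

text \<open>The common element \<open>\<top>\<^bsub>A\<^esub> = \<bottom>\<^bsub>B\<^esub>\<close> of the ordinal sum is represented by \<open>Inl \<top>\<^bsub>A\<^esub>\<close>,
  so \<open>Inr \<bottom>\<^bsub>B\<^esub>\<close> is left out. The definition is meant for \<open>A\<close> with a greatest and \<open>B\<close> with a
  least element.\<close>

definition ordinal_sum ::
    "('a, 'm) gorder_scheme \<Rightarrow> ('b, 'k) gorder_scheme \<Rightarrow> ('a + 'b) gorder" (infixr \<open>\<dotplus>\<^sub>l\<close> 65) where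
  "A \<dotplus>\<^sub>l B = \<lparr>carrier = Inl ` carrier A \<union> Inr ` (carrier B - {\<bottom>\<^bsub>B\<^esub>}), eq = (=),
     le = (\<lambda>x y. case x of
             Inl a \<Rightarrow> (case y of Inl a' \<Rightarrow> a \<sqsubseteq>\<^bsub>A\<^esub> a' | Inr b' \<Rightarrow> True)
           | Inr b \<Rightarrow> (case y of Inl a' \<Rightarrow> False | Inr b' \<Rightarrow> b \<sqsubseteq>\<^bsub>B\<^esub> b'))\<rparr>"

end

theory Submission
  imports Defs
begin

text \<open>A congruence of a finite lattice \<open>L\<close> is determined by the set \<open>E\<close> of those join-irreducible
  elements \<open>j\<close> that it identifies with something strictly smaller: it identifies \<open>x\<close> and \<open>y\<close> exactly
  when the same join-irreducibles outside \<open>E\<close> lie below both. Conversely, a set \<open>E\<close> of join-irreducibles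
  arises in this way as soon as the relation so described respects joins; call such sets
  admissible. So \<open>Con L\<close> is isomorphic to the family of admissible sets, ordered by inclusion, and
  has at most \<open>2 ^ j\<close> elements, where \<open>j\<close> is the number of join-irreducibles
  (\<open>congruence_eq_cong_of\<close>, \<open>bij_cong_of\<close>). If it has exactly \<open>2 ^ j\<close>, it is Boolean.

  Every element of \<open>L\<close> is the bottom, join-irreducible, or the join of two incomparable elements, so
  \<open>n = j + r + 1\<close> with \<open>r\<close> the number of elements of the last kind. The count of congruences therefore
  bounds \<open>r\<close>: it forces \<open>r = 0\<close> in part (1), \<open>r \<le> 1\<close> in parts (2) and (3), and \<open>r \<le> 2\<close> in part (4).

  If \<open>r = 0\<close>, then \<open>L\<close> is a chain and all sets are admissible. If \<open>r = 1\<close>, let \<open>u\<close> be the only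
  join-reducible element and choose \<open>a\<close> minimal among the elements incomparable to something, and \<open>b\<close>
  minimal among the elements incomparable to \<open>a\<close>. Then \<open>a\<close> and \<open>b\<close> have the same strict lower bounds, and
  collapsing either of them forces the collapse of every join-irreducible in the set \<open>C\<close> of those
  below \<open>u\<close> but below neither \<open>a\<close> nor \<open>b\<close>. There are three outcomes
  (\<open>one_reducible_trichotomy\<close>): \<open>C\<close> is empty and all sets are admissible; \<open>C = {c}\<close>, the elements
  \<open>a\<close>, \<open>b\<close>, \<open>c\<close> are the inner elements of a pentagon with top \<open>u\<close>, and the admissible sets are those containing \<open>c\<close> whenever they contain \<open>a\<close>
  or \<open>b\<close>, which is the lattice of part (3); or fewer than half of all sets are admissible. If
  \<open>r = 2\<close> and the count is \<open>2 ^ j\<close>, then \<open>Con L\<close> is Boolean, and two join-reducible elements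
  need at least six elements of \<open>L\<close>. Comparing the counts leaves in each part just the claimed case.\<close>

section \<open>Rings of sets as lattices\<close>

text \<open>An order isomorphism from a family of sets under inclusion onto \<open>A\<close>. Both \<open>Con L\<close> and the lattices
  that it is compared with are presented in this way, over the same family.\<close>

definition represents :: "'s set set \<Rightarrow> ('a, 'm) gorder_scheme \<Rightarrow> ('s set \<Rightarrow> 'a) \<Rightarrow> bool" where
  "represents F A f \<longleftrightarrow> bij_betw f F (carrier A) \<and>
     (\<forall>X\<in>F. \<forall>Y\<in>F. f X \<sqsubseteq>\<^bsub>A\<^esub> f Y \<longleftrightarrow> X \<subseteq> Y) \<and> eq A = (=)"

lemma representsI:
  assumes "eq A = (=)"
    and "\<And>X Y. X \<in> F \<Longrightarrow> Y \<in> F \<Longrightarrow> f X \<sqsubseteq>\<^bsub>A\<^esub> f Y \<longleftrightarrow> X \<subseteq> Y"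
    and "\<And>X. X \<in> F \<Longrightarrow> f X \<in> carrier A"
    and "\<And>y. y \<in> carrier A \<Longrightarrow> \<exists>X\<in>F. f X = y"
  shows "represents F A f"
proof -
  have "inj_on f F" using assms(2) by (metis inj_onI order_refl subset_antisym)
  moreover have "f ` F = carrier A" using assms(3,4) by blast
  ultimately show ?thesis using assms(1,2) by (simp add: represents_def bij_betw_def)
qed

text \<open>For a family closed under unions and intersections these two operations are the join and the meet,
  and an order isomorphism carries suprema and infima along.\<close>

lemma ring_of_sets_lattice:
  assumes closed: "\<forall>X\<in>F. \<forall>Y\<in>F. X \<union> Y \<in> F \<and> X \<inter> Y \<in> F"
    and rep: "represents F A f"
  shows "lattice A"
    and "\<And>X Y. X \<in> F \<Longrightarrow> Y \<in> F \<Longrightarrow> f X \<squnion>\<^bsub>A\<^esub> f Y = f (X \<union> Y)"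
    and "\<And>X Y. X \<in> F \<Longrightarrow> Y \<in> F \<Longrightarrow> f X \<sqinter>\<^bsub>A\<^esub> f Y = f (X \<inter> Y)"
proof -
  have eq: "eq A = (=)" and im: "carrier A = f ` F"
    and le: "\<And>X Y. X \<in> F \<Longrightarrow> Y \<in> F \<Longrightarrow> f X \<sqsubseteq>\<^bsub>A\<^esub> f Y \<longleftrightarrow> X \<subseteq> Y"
    using rep by (auto simp: represents_def bij_betw_def)
  have sup: "least A (f (X \<union> Y)) (Upper A {f X, f Y})" if "X \<in> F" "Y \<in> F" for X Y
    using that closed[rule_format, OF that] by (intro least_UpperI) (auto simp: im le Upper_def)
  have inf: "greatest A (f (X \<inter> Y)) (Lower A {f X, f Y})" if "X \<in> F" "Y \<in> F" for X Y
    using that closed[rule_format, OF that] by (intro greatest_LowerI) (auto simp: im le Lower_def)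
  interpret A: partial_order A
  proof
    show "x .=\<^bsub>A\<^esub> y" if "x \<sqsubseteq>\<^bsub>A\<^esub> y" "y \<sqsubseteq>\<^bsub>A\<^esub> x" "x \<in> carrier A" "y \<in> carrier A" for x y
      using that le by (auto simp: im eq)
    show "x \<sqsubseteq>\<^bsub>A\<^esub> z" if "x \<sqsubseteq>\<^bsub>A\<^esub> y" "y \<sqsubseteq>\<^bsub>A\<^esub> z" "x \<in> carrier A" "y \<in> carrier A" "z \<in> carrier A" for x y z
      using that le by (auto simp: im)
  qed (auto simp: eq im le)
  show lat: "lattice A"
  proof unfold_locales
    fix x y assume "x \<in> carrier A" "y \<in> carrier A"
    then obtain X Y where XY: "X \<in> F" "Y \<in> F" "x = f X" "y = f Y" by (auto simp: im)
    show "\<exists>s. least A s (Upper A {x, y})" using sup[OF XY(1,2)] XY(3,4) by auto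
    show "\<exists>s. greatest A s (Lower A {x, y})" using inf[OF XY(1,2)] XY(3,4) by auto
  qed
  interpret A: lattice A by (rule lat)
  show "f X \<squnion>\<^bsub>A\<^esub> f Y = f (X \<union> Y)" if "X \<in> F" "Y \<in> F" for X Y
    using A.least_unique[OF A.sup_of_two_least sup[OF that]] that by (simp add: join_def im)
  show "f X \<sqinter>\<^bsub>A\<^esub> f Y = f (X \<inter> Y)" if "X \<in> F" "Y \<in> F" for X Y
    using A.greatest_unique[OF A.inf_of_two_greatest inf[OF that]] that by (simp add: meet_def im)
qed

lemma isomorphic_if_represents:
  assumes closed: "\<forall>X\<in>F. \<forall>Y\<in>F. X \<union> Y \<in> F \<and> X \<inter> Y \<in> F"
    and f: "represents F A f" and g: "represents F B g"
  shows "A \<cong>\<^sub>l B"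
proof -
  note A = ring_of_sets_lattice[OF closed f] and B = ring_of_sets_lattice[OF closed g]
  have bf: "bij_betw f F (carrier A)" and bg: "bij_betw g F (carrier B)"
    using f g by (auto simp: represents_def)
  let ?h = "g \<circ> inv_into F f"
  have h: "?h (f X) = g X" if "X \<in> F" for X
    using that bf by (simp add: bij_betw_def)
  have im: "carrier A = f ` F" using bf by (simp add: bij_betw_def)
  have "?h (f X \<squnion>\<^bsub>A\<^esub> f Y) = ?h (f X) \<squnion>\<^bsub>B\<^esub> ?h (f Y)" "?h (f X \<sqinter>\<^bsub>A\<^esub> f Y) = ?h (f X) \<sqinter>\<^bsub>B\<^esub> ?h (f Y)"
    if "X \<in> F" "Y \<in> F" for X Y
    using A(2,3)[OF that] B(2,3)[OF that] h closed[rule_format, OF that] that by presburger+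
  then have "join_pres A B ?h" "meet_pres A B ?h"
    using A(1) B(1) unfolding join_pres_def meet_pres_def im by blast+
  moreover have "bij_betw ?h (carrier A) (carrier B)"
    using bij_betw_trans[OF bij_betw_inv_into[OF bf] bg] .
  ultimately show ?thesis unfolding lattice_isomorphic_def lattice_iso_def by blast
qed

section \<open>Concrete models: powers of the chain and the sum\<close>

text \<open>The down-sets of \<open>S\<close> for the order in which \<open>c\<close> is below \<open>a\<close> and \<open>b\<close> and there are no other
  relations. This is how the congruences of a pentagon with chains attached look: the
  middle edge of the long side is collapsed as soon as the lowest edge of either side is.\<close>

definition tied_sets :: "'a set \<Rightarrow> 'a \<Rightarrow> 'a \<Rightarrow> 'a \<Rightarrow> 'a set set" where
  "tied_sets S a b c = {E \<in> Pow S. (a \<in> E \<or> b \<in> E \<longrightarrow> c \<in> E)}"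

definition indicator :: "nat \<Rightarrow> (nat \<Rightarrow> 's) \<Rightarrow> 's set \<Rightarrow> nat \<Rightarrow> bool" where
  "indicator s e X = (\<lambda>i\<in>{..<s}. e i \<in> X)"

lemma carrier_power: "carrier (\<L>\<^sub>2 [^]\<^sub>l s) = extensional {..<s}"
  by (auto simp: lattice_power_def chain2_def PiE_def)

lemma le_power: "f \<sqsubseteq>\<^bsub>\<L>\<^sub>2 [^]\<^sub>l s\<^esub> g \<longleftrightarrow> (\<forall>i<s. f i \<longrightarrow> g i)"
  by (auto simp: lattice_power_def chain2_def)

lemma carrier_chain2: "carrier \<L>\<^sub>2 = UNIV"
  by (simp add: chain2_def)

lemma le_chain2: "p \<sqsubseteq>\<^bsub>\<L>\<^sub>2\<^esub> q \<longleftrightarrow> (p \<longrightarrow> q)"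
  by (auto simp: chain2_def)

lemma indicator_le:
  assumes "e ` {..<s} = S"
  shows "indicator s e X \<sqsubseteq>\<^bsub>\<L>\<^sub>2 [^]\<^sub>l s\<^esub> indicator s e Y \<longleftrightarrow> X \<inter> S \<subseteq> Y"
  using assms by (auto simp: le_power indicator_def)

lemma indicator_inverse:
  assumes "inj_on e {..<s}" "f \<in> extensional {..<s}"
  shows "indicator s e (e ` {i. i < s \<and> f i}) = f"
  using assms by (auto simp: indicator_def extensional_def inj_on_def fun_eq_iff)

lemma represents_Pow:
  assumes "bij_betw e {..<s} S"
  shows "represents (Pow S) (\<L>\<^sub>2 [^]\<^sub>l s) (indicator s e)"
proof (rule representsI)
  have im: "e ` {..<s} = S" and inj: "inj_on e {..<s}" using assms by (auto simp: bij_betw_def)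
  show "indicator s e X \<sqsubseteq>\<^bsub>\<L>\<^sub>2 [^]\<^sub>l s\<^esub> indicator s e Y \<longleftrightarrow> X \<subseteq> Y" if "X \<in> Pow S" "Y \<in> Pow S" for X Y
    using indicator_le[OF im] that by (metis Int_absorb2 PowD)
  show "\<exists>X\<in>Pow S. indicator s e X = f" if "f \<in> carrier (\<L>\<^sub>2 [^]\<^sub>l s)" for f
    using indicator_inverse[OF inj] that im by (intro bexI[of _ "e ` {i. i < s \<and> f i}"]) (auto simp: carrier_power)
qed (auto simp: lattice_power_def chain2_def indicator_def)

lemma bottom_power: "\<bottom>\<^bsub>\<L>\<^sub>2 [^]\<^sub>l s\<^esub> = (\<lambda>i\<in>{..<s}. False)"
proof -
  have "least (\<L>\<^sub>2 [^]\<^sub>l s) x (carrier (\<L>\<^sub>2 [^]\<^sub>l s)) \<longleftrightarrow> x = (\<lambda>i\<in>{..<s}. False)" for x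
  proof
    assume l: "least (\<L>\<^sub>2 [^]\<^sub>l s) x (carrier (\<L>\<^sub>2 [^]\<^sub>l s))"
    then have "x \<in> extensional {..<s}" by (auto simp: least_def carrier_power)
    moreover have "x \<sqsubseteq>\<^bsub>\<L>\<^sub>2 [^]\<^sub>l s\<^esub> (\<lambda>i\<in>{..<s}. False)"
      by (rule least_le[OF l]) (simp add: carrier_power)
    ultimately show "x = (\<lambda>i\<in>{..<s}. False)" by (auto simp: le_power extensional_def fun_eq_iff)
  qed (auto simp: least_def carrier_power le_power)
  then show ?thesis by (simp add: bottom_def)
qed

text \<open>The function left out of the right summand is the bottom of the square, constantly \<open>False\<close>.\<close>

lemma carrier_ordinal_sum:
  "q \<in> carrier (\<L>\<^sub>2 \<dotplus>\<^sub>l \<L>\<^sub>2 [^]\<^sub>l 2) \<longleftrightarrow>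
     (case q of Inl t \<Rightarrow> True | Inr r \<Rightarrow> r \<in> extensional {..<2} \<and> (r 0 \<or> r (Suc 0)))"
proof -
  have "r = (\<lambda>i\<in>{..<2}. False) \<longleftrightarrow> \<not> r 0 \<and> \<not> r (Suc 0)" if "r \<in> extensional {..<2}" for r :: "nat \<Rightarrow> bool"
    using that by (auto simp: extensional_def fun_eq_iff less_2_cases_iff)
  then show ?thesis
    by (auto simp: ordinal_sum_def carrier_chain2 carrier_power bottom_power split: sum.splits)
qed

text \<open>How a tied set meets \<open>{a, b, c}\<close>. Its five possible traces are the empty set, \<open>{c}\<close>, and \<open>{c}\<close>
  joined with a nonempty part of \<open>{a, b}\<close>. The first two form the lower chain of the sum, and \<open>{c}\<close>
  is the glued point: it is at once the top of the chain and the bottom of the square, which is why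
  only nonempty parts of \<open>{a, b}\<close> go to the right summand.\<close>

definition tied_code :: "'s \<Rightarrow> 's \<Rightarrow> 's \<Rightarrow> 's set \<Rightarrow> bool + (nat \<Rightarrow> bool)" where
  "tied_code a b c E = (if a \<in> E \<or> b \<in> E then Inr (\<lambda>i\<in>{..<2}. (if i = 0 then a else b) \<in> E)
     else Inl (c \<in> E))"

lemma represents_tied_sets:
  assumes e: "bij_betw e {..<s} (S - {a, b, c})" and abc: "{a, b, c} \<subseteq> S" "distinct [a, b, c]"
  shows "represents (tied_sets S a b c) (\<L>\<^sub>2 [^]\<^sub>l s \<times>\<^sub>l (\<L>\<^sub>2 \<dotplus>\<^sub>l \<L>\<^sub>2 [^]\<^sub>l 2))
           (\<lambda>E. (indicator s e E, tied_code a b c E))"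
proof (rule representsI)
  have im: "e ` {..<s} = S - {a, b, c}" and inj: "inj_on e {..<s}" using e by (auto simp: bij_betw_def)
  have two: "(\<forall>i<2. P i) \<longleftrightarrow> P 0 \<and> P (Suc 0)" for P :: "nat \<Rightarrow> bool"
    by (auto simp: less_2_cases_iff)
  show "eq (\<L>\<^sub>2 [^]\<^sub>l s \<times>\<^sub>l (\<L>\<^sub>2 \<dotplus>\<^sub>l \<L>\<^sub>2 [^]\<^sub>l 2)) = (=)" by (simp add: lattice_prod_def)
  fix X Y assume X: "X \<in> tied_sets S a b c" and Y: "Y \<in> tied_sets S a b c"
  have "tied_code a b c X \<sqsubseteq>\<^bsub>\<L>\<^sub>2 \<dotplus>\<^sub>l \<L>\<^sub>2 [^]\<^sub>l 2\<^esub> tied_code a b c Y \<longleftrightarrow> X \<inter> {a, b, c} \<subseteq> Y"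
    using X Y abc(2)
    by (auto simp: ordinal_sum_def tied_code_def le_power two le_chain2 tied_sets_def)
  moreover have "X \<subseteq> Y \<longleftrightarrow> X \<inter> (S - {a, b, c}) \<subseteq> Y \<and> X \<inter> {a, b, c} \<subseteq> Y"
    using X by (auto simp: tied_sets_def)
  ultimately show "(indicator s e X, tied_code a b c X)
      \<sqsubseteq>\<^bsub>\<L>\<^sub>2 [^]\<^sub>l s \<times>\<^sub>l (\<L>\<^sub>2 \<dotplus>\<^sub>l \<L>\<^sub>2 [^]\<^sub>l 2)\<^esub> (indicator s e Y, tied_code a b c Y) \<longleftrightarrow> X \<subseteq> Y"
    using indicator_le[OF im, of X Y] by (simp add: lattice_prod_def)
  have "tied_code a b c X \<in> carrier (\<L>\<^sub>2 \<dotplus>\<^sub>l \<L>\<^sub>2 [^]\<^sub>l 2)"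
    by (auto simp: carrier_ordinal_sum tied_code_def)
  then show "(indicator s e X, tied_code a b c X) \<in> carrier (\<L>\<^sub>2 [^]\<^sub>l s \<times>\<^sub>l (\<L>\<^sub>2 \<dotplus>\<^sub>l \<L>\<^sub>2 [^]\<^sub>l 2))"
    by (simp add: lattice_prod_def carrier_power indicator_def)
next
  have im: "e ` {..<s} = S - {a, b, c}" and inj: "inj_on e {..<s}" using e by (auto simp: bij_betw_def)
  fix p assume "p \<in> carrier (\<L>\<^sub>2 [^]\<^sub>l s \<times>\<^sub>l (\<L>\<^sub>2 \<dotplus>\<^sub>l \<L>\<^sub>2 [^]\<^sub>l 2))"
  then obtain f q where p: "p = (f, q)" "f \<in> extensional {..<s}"
    and q: "q \<in> carrier (\<L>\<^sub>2 \<dotplus>\<^sub>l \<L>\<^sub>2 [^]\<^sub>l 2)"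
    by (auto simp: lattice_prod_def carrier_power)
  let ?D = "e ` {i. i < s \<and> f i}"
  have D: "?D \<subseteq> S - {a, b, c}" using im by auto
  have "\<exists>Z. Z \<subseteq> {a, b, c} \<and> (a \<in> Z \<or> b \<in> Z \<longrightarrow> c \<in> Z) \<and> tied_code a b c Z = q"
  proof (cases q)
    case (Inl t)
    then show ?thesis
      using abc(2) by (intro exI[of _ "if t then {c} else {}"]) (auto simp: tied_code_def)
  next
    case (Inr r)
    then have r: "r \<in> extensional {..<2}" and nz: "r 0 \<or> r (Suc 0)"
      using q by (auto simp: carrier_ordinal_sum)
    have "(\<lambda>i\<in>{..<2}. (if i = 0 then r 0 else r (Suc 0))) = r"
      using r by (auto simp: extensional_def fun_eq_iff less_2_cases_iff)
    then show ?thesis using abc(2) Inr nz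
      by (intro exI[of _ "{c} \<union> (if r 0 then {a} else {}) \<union> (if r (Suc 0) then {b} else {})"])
        (auto simp: tied_code_def cong: if_cong)
  qed
  then obtain Z where Z: "Z \<subseteq> {a, b, c}" "a \<in> Z \<or> b \<in> Z \<longrightarrow> c \<in> Z" "tied_code a b c Z = q" by blast
  let ?E = "?D \<union> Z"
  have mem: "a \<in> ?E \<longleftrightarrow> a \<in> Z" "b \<in> ?E \<longleftrightarrow> b \<in> Z" "c \<in> ?E \<longleftrightarrow> c \<in> Z" using D by auto
  then have "(if i = 0 then a else b) \<in> ?E \<longleftrightarrow> (if i = 0 then a else b) \<in> Z" for i :: nat by simp
  then have "tied_code a b c ?E = tied_code a b c Z" unfolding tied_code_def mem by simp
  then have "tied_code a b c ?E = q" using Z(3) by simp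
  moreover have "indicator s e ?E = indicator s e ?D"
    using im Z(1) by (auto simp: indicator_def fun_eq_iff)
  then have "indicator s e ?E = f" using indicator_inverse[OF inj p(2)] by simp
  moreover have "?E \<in> tied_sets S a b c" using D Z(1,2) abc(1) unfolding tied_sets_def by blast
  ultimately show "\<exists>E\<in>tied_sets S a b c. (indicator s e E, tied_code a b c E) = p"
    using p(1) by blast
qed

section \<open>Counting families of sets by their traces\<close>

text \<open>Outside \<open>X\<close> the sets are unconstrained: each is a trace in \<open>H\<close> together with any subset of \<open>S - X\<close>.\<close>

lemma card_prescribed_trace:
  assumes "finite S" "X \<subseteq> S" "H \<subseteq> Pow X"
  shows "card {E \<in> Pow S. E \<inter> X \<in> H} = card H * 2 ^ (card S - card X)"
proof -
  have "bij_betw (\<lambda>E. (E \<inter> X, E - X)) {E \<in> Pow S. E \<inter> X \<in> H} (H \<times> Pow (S - X))"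
  proof (rule bij_betw_byWitness[where f' = "\<lambda>(Y, Z). Y \<union> Z"])
    have tr: "(Y \<union> Z) \<inter> X = Y \<and> (Y \<union> Z) - X = Z" if "Y \<in> H" "Z \<in> Pow (S - X)" for Y Z
      using that assms(3) by blast
    show "\<forall>E\<in>{E \<in> Pow S. E \<inter> X \<in> H}. (case (E \<inter> X, E - X) of (Y, Z) \<Rightarrow> Y \<union> Z) = E" by auto
    show "\<forall>p\<in>H \<times> Pow (S - X). ((case p of (Y, Z) \<Rightarrow> Y \<union> Z) \<inter> X, (case p of (Y, Z) \<Rightarrow> Y \<union> Z) - X) = p"
      using tr by auto
    show "(\<lambda>E. (E \<inter> X, E - X)) ` {E \<in> Pow S. E \<inter> X \<in> H} \<subseteq> H \<times> Pow (S - X)" by auto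
    show "(\<lambda>(Y, Z). Y \<union> Z) ` (H \<times> Pow (S - X)) \<subseteq> {E \<in> Pow S. E \<inter> X \<in> H}"
    proof (rule image_subsetI)
      fix p assume "p \<in> H \<times> Pow (S - X)"
      then obtain Y Z where YZ: "p = (Y, Z)" "Y \<in> H" "Z \<subseteq> S - X" by blast
      then have "Y \<union> Z \<subseteq> S" using assms(2,3) by blast
      then show "(case p of (Y, Z) \<Rightarrow> Y \<union> Z) \<in> {E \<in> Pow S. E \<inter> X \<in> H}"
        using tr[of Y Z] YZ by simp
    qed
  qed
  then have "card {E \<in> Pow S. E \<inter> X \<in> H} = card (H \<times> Pow (S - X))" by (rule bij_betw_same_card)
  also have "\<dots> = card H * 2 ^ (card S - card X)"
    using assms by (simp add: card_cartesian_product card_Pow card_Diff_subset finite_subset)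
  finally show ?thesis .
qed

lemma card_less_half_if_trace:
  assumes "finite S" "X \<subseteq> S" "H \<subseteq> Pow X" "F \<subseteq> Pow S" "\<And>E. E \<in> F \<Longrightarrow> E \<inter> X \<in> H"
    and few: "2 * card H < 2 ^ card X"
  shows "2 * card F < 2 ^ card S"
proof -
  have "card F \<le> card {E \<in> Pow S. E \<inter> X \<in> H}"
    by (rule card_mono) (use assms in auto)
  then have "2 * card F \<le> 2 * card H * 2 ^ (card S - card X)"
    using card_prescribed_trace[OF assms(1-3)] by simp
  also have "\<dots> < 2 ^ card X * 2 ^ (card S - card X)" using few by simp
  also have "\<dots> = 2 ^ card S"
    using card_mono[OF assms(1,2)] by (simp flip: power_add)
  finally show ?thesis .
qed

lemma card_tied_sets:
  assumes "finite S" "{a, b, c} \<subseteq> S" "distinct [a, b, c]"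
  shows "card (tied_sets S a b c) = 5 * 2 ^ (card S - 3)"
proof -
  let ?H = "{{}, {c}, {a, c}, {b, c}, {a, b, c}}"
  have "tied_sets S a b c = {E \<in> Pow S. E \<inter> {a, b, c} \<in> ?H}"
    unfolding tied_sets_def using assms(3) by auto
  moreover have "card ?H = 5" using assms(3) by (auto simp: card_insert_if)
  moreover have "card {a, b, c} = 3" using assms(3) by simp
  ultimately show ?thesis using card_prescribed_trace[OF assms(1,2), of ?H] by auto
qed

section \<open>Finite lattices and their join-irreducible elements\<close>

locale finite_lattice = lattice L for L (structure) +
  assumes finite_carrier: "finite (carrier L)"
begin

(* Equivalence is equality here, so the rules for .= only enlarge the search space. *)
declare le_cong_l [rule del] le_cong_r [rule del] weak_le_antisym [rule del] weak_refl [rule del, simp del]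

lemma meet_absorb: "x \<in> carrier L \<Longrightarrow> y \<in> carrier L \<Longrightarrow> x \<sqsubseteq> y \<Longrightarrow> x \<sqinter> y = x"
  using le_iff_join by simp

lemma join_absorb: "x \<in> carrier L \<Longrightarrow> y \<in> carrier L \<Longrightarrow> x \<sqsubseteq> y \<Longrightarrow> x \<squnion> y = y"
  using le_iff_meet by simp

lemma join_le_iff:
  "x \<in> carrier L \<Longrightarrow> y \<in> carrier L \<Longrightarrow> z \<in> carrier L \<Longrightarrow> x \<squnion> y \<sqsubseteq> z \<longleftrightarrow> x \<sqsubseteq> z \<and> y \<sqsubseteq> z"
  by (meson join_closed join_le join_left join_right le_trans)

lemma le_meet_iff:
  "x \<in> carrier L \<Longrightarrow> y \<in> carrier L \<Longrightarrow> z \<in> carrier L \<Longrightarrow> z \<sqsubseteq> x \<sqinter> y \<longleftrightarrow> z \<sqsubseteq> x \<and> z \<sqsubseteq> y"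
  by (meson meet_closed meet_le meet_left meet_right le_trans)

lemma meet_mono: "x \<in> carrier L \<Longrightarrow> y \<in> carrier L \<Longrightarrow> z \<in> carrier L \<Longrightarrow> x \<sqsubseteq> y \<Longrightarrow> x \<sqinter> z \<sqsubseteq> y \<sqinter> z"
  by (simp add: le_meet_iff meet_right le_trans[OF meet_left])

lemma join_mono: "x \<in> carrier L \<Longrightarrow> y \<in> carrier L \<Longrightarrow> z \<in> carrier L \<Longrightarrow> x \<sqsubseteq> y \<Longrightarrow> x \<squnion> z \<sqsubseteq> y \<squnion> z"
  by (simp add: join_le_iff join_right le_trans[OF _ join_left])

lemma card_down_less:
  assumes "x \<in> carrier L" "y \<in> carrier L" "x \<sqsubseteq> y" "x \<noteq> y"
  shows "card {z \<in> carrier L. z \<sqsubseteq> x} < card {z \<in> carrier L. z \<sqsubseteq> y}"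
proof (rule psubset_card_mono)
  show "finite {z \<in> carrier L. z \<sqsubseteq> y}" using finite_carrier by simp
  have "y \<notin> {z \<in> carrier L. z \<sqsubseteq> x}" using assms le_antisym by blast
  moreover have "y \<in> {z \<in> carrier L. z \<sqsubseteq> y}" using assms by simp
  moreover have "{z \<in> carrier L. z \<sqsubseteq> x} \<subseteq> {z \<in> carrier L. z \<sqsubseteq> y}"
    using assms le_trans by blast
  ultimately show "{z \<in> carrier L. z \<sqsubseteq> x} \<subset> {z \<in> carrier L. z \<sqsubseteq> y}" by blast
qed

lemma le_induct [consumes 1, case_names less]:
  assumes "x \<in> carrier L"
    and step: "\<And>x. x \<in> carrier L \<Longrightarrow>
      (\<And>y. y \<in> carrier L \<Longrightarrow> y \<sqsubseteq> x \<Longrightarrow> y \<noteq> x \<Longrightarrow> P y) \<Longrightarrow> P x"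
  shows "P x"
  using assms(1)
proof (induction "card {z \<in> carrier L. z \<sqsubseteq> x}" arbitrary: x rule: less_induct)
  case less
  show ?case
    by (rule step[OF less.prems]) (rule less.hyps[OF card_down_less], use less.prems in auto)
qed

lemma obtain_minimal:
  assumes "A \<subseteq> carrier L" "A \<noteq> {}"
  obtains m where "m \<in> A" "\<And>z. z \<in> A \<Longrightarrow> z \<sqsubseteq> m \<Longrightarrow> z = m"
proof -
  have "\<exists>m. m \<in> A \<and> (\<forall>z\<in>A. z \<sqsubseteq> m \<longrightarrow> z = m)" if "x \<in> A" for x
  proof -
    have "x \<in> carrier L" using that assms by blast
    then show ?thesis using that
    proof (induction rule: le_induct)
      case (less x)
      then show ?case using assms(1) by blast
    qed
  qed
  then show ?thesis using that assms(2) by blast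
qed

lemma obtain_maximal:
  assumes "A \<subseteq> carrier L" "A \<noteq> {}"
  obtains m where "m \<in> A" "\<And>z. z \<in> A \<Longrightarrow> m \<sqsubseteq> z \<Longrightarrow> z = m"
proof -
  let ?f = "\<lambda>x. card {z \<in> carrier L. z \<sqsubseteq> x}"
  have fin: "finite A" using assms(1) finite_carrier finite_subset by blast
  obtain m where m: "m \<in> A" "(MAX x\<in>A. ?f x) = ?f m"
    by (rule obtains_MAX[OF fin assms(2), where f = ?f])
  have "z = m" if "z \<in> A" "m \<sqsubseteq> z" for z
  proof (rule ccontr)
    assume "z \<noteq> m"
    then have "?f m < ?f z" using card_down_less m(1) that assms(1) by blast
    moreover have "?f z \<le> ?f m" using m(2) Max_ge[of "?f ` A" "?f z"] fin that(1) by auto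
    ultimately show False by simp
  qed
  then show ?thesis using that m(1) by blast
qed

text \<open>The existence of an element that is not above \<open>j\<close> excludes the bottom.\<close>

definition join_irreducibles :: "'a set" (\<open>J\<close>) where
  "J = {j \<in> carrier L. (\<exists>x\<in>carrier L. \<not> j \<sqsubseteq> x) \<and>
         (\<forall>x\<in>carrier L. \<forall>y\<in>carrier L. x \<squnion> y = j \<longrightarrow> x = j \<or> y = j)}"

definition below :: "'a \<Rightarrow> 'a set" where
  "below x = {j \<in> J. j \<sqsubseteq> x}"

text \<open>Two elements are related when they have the same join-irreducibles below them up to \<open>E\<close>. This is
  always an equivalence and always respects meets, since \<open>below\<close> turns meets into intersections;
  only joins impose a condition on \<open>E\<close>.\<close>

definition cong_of :: "'a set \<Rightarrow> ('a \<times> 'a) set" where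
  "cong_of E = {(x, y). x \<in> carrier L \<and> y \<in> carrier L \<and> below x - E = below y - E}"

definition admissible :: "'a set set" where
  "admissible = {E. E \<subseteq> J \<and> (\<forall>x\<in>carrier L. \<forall>y\<in>carrier L. \<forall>z\<in>carrier L.
     below x - E = below y - E \<longrightarrow> below (x \<squnion> z) - E = below (y \<squnion> z) - E)}"

lemma J_carrier: "J \<subseteq> carrier L"
  by (auto simp: join_irreducibles_def)

lemma J_joinD: "x \<squnion> y \<in> J \<Longrightarrow> x \<in> carrier L \<Longrightarrow> y \<in> carrier L \<Longrightarrow> x = x \<squnion> y \<or> y = x \<squnion> y"
  by (auto simp: join_irreducibles_def)

lemma finite_J: "finite J"
  using J_carrier finite_carrier finite_subset by blast

lemma below_J: "below x \<subseteq> J"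
  by (auto simp: below_def)

lemma below_mono: "x \<in> carrier L \<Longrightarrow> y \<in> carrier L \<Longrightarrow> x \<sqsubseteq> y \<Longrightarrow> below x \<subseteq> below y"
  unfolding below_def using J_carrier le_trans by blast

lemma below_meet: "x \<in> carrier L \<Longrightarrow> y \<in> carrier L \<Longrightarrow> below (x \<sqinter> y) = below x \<inter> below y"
  unfolding below_def using J_carrier le_meet_iff by blast

text \<open>A join-irreducible element has a single lower cover, and everything strictly below it lies below
  that cover: a maximal \<open>w\<close> strictly below \<open>j\<close> absorbs every \<open>z\<close> strictly below \<open>j\<close>, because their join
  stays strictly below \<open>j\<close>.\<close>

lemma obtain_below_minus:
  assumes "j \<in> J"
  obtains w where "w \<in> carrier L" "w \<sqsubseteq> j" "w \<noteq> j" "below w = below j - {j}"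
proof -
  have jc: "j \<in> carrier L" using assms J_carrier by blast
  let ?A = "{z \<in> carrier L. z \<sqsubseteq> j \<and> z \<noteq> j}"
  obtain x where x: "x \<in> carrier L" "\<not> j \<sqsubseteq> x" using assms by (auto simp: join_irreducibles_def)
  then have "j \<sqinter> x \<in> ?A" using jc meet_left meet_right by (metis (mono_tags, lifting) mem_Collect_eq meet_closed)
  then obtain w where w: "w \<in> ?A" and max: "\<And>z. z \<in> ?A \<Longrightarrow> w \<sqsubseteq> z \<Longrightarrow> z = w"
    using obtain_maximal[of ?A] by blast
  have le: "z \<sqsubseteq> w" if z: "z \<in> ?A" for z
  proof -
    have "w \<squnion> z \<noteq> j" using J_joinD[of w z] assms w z by auto
    then have "w \<squnion> z \<in> ?A" using w z jc join_le_iff by auto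
    then have "w \<squnion> z = w" using max w z join_left by auto
    then show ?thesis using w z join_right by (metis (mono_tags, lifting) mem_Collect_eq)
  qed
  have "below w = below j - {j}"
  proof
    show "below w \<subseteq> below j - {j}"
      using below_mono[of w j] w jc le_antisym by (auto simp: below_def)
    show "below j - {j} \<subseteq> below w"
      using le J_carrier by (auto simp: below_def)
  qed
  then show ?thesis using that w by blast
qed

section \<open>Congruences as sets of join-irreducible elements\<close>

lemma congruence_rules:
  assumes "lattice_congruence L \<theta>"
  shows "\<And>x y. (x, y) \<in> \<theta> \<Longrightarrow> x \<in> carrier L \<and> y \<in> carrier L"
    and "\<And>x. x \<in> carrier L \<Longrightarrow> (x, x) \<in> \<theta>"
    and "\<And>x y. (x, y) \<in> \<theta> \<Longrightarrow> (y, x) \<in> \<theta>"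
    and "\<And>x y z. (x, y) \<in> \<theta> \<Longrightarrow> (y, z) \<in> \<theta> \<Longrightarrow> (x, z) \<in> \<theta>"
    and "\<And>x y z w. (x, y) \<in> \<theta> \<Longrightarrow> (z, w) \<in> \<theta> \<Longrightarrow> (x \<squnion> z, y \<squnion> w) \<in> \<theta>"
    and "\<And>x y z w. (x, y) \<in> \<theta> \<Longrightarrow> (z, w) \<in> \<theta> \<Longrightarrow> (x \<sqinter> z, y \<sqinter> w) \<in> \<theta>"
proof -
  have e: "equiv (carrier L) \<theta>" using assms by (simp add: lattice_congruence_def)
  show "\<And>x y. (x, y) \<in> \<theta> \<Longrightarrow> x \<in> carrier L \<and> y \<in> carrier L" using e by (auto simp: equiv_def)
  show "\<And>x. x \<in> carrier L \<Longrightarrow> (x, x) \<in> \<theta>" using e by (auto simp: equiv_def refl_on_def)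
  show "\<And>x y. (x, y) \<in> \<theta> \<Longrightarrow> (y, x) \<in> \<theta>" using e by (auto simp: equiv_def dest: symD)
  show "\<And>x y z. (x, y) \<in> \<theta> \<Longrightarrow> (y, z) \<in> \<theta> \<Longrightarrow> (x, z) \<in> \<theta>" using e unfolding equiv_def by (meson transD)
  show "\<And>x y z w. (x, y) \<in> \<theta> \<Longrightarrow> (z, w) \<in> \<theta> \<Longrightarrow> (x \<squnion> z, y \<squnion> w) \<in> \<theta>"
    and "\<And>x y z w. (x, y) \<in> \<theta> \<Longrightarrow> (z, w) \<in> \<theta> \<Longrightarrow> (x \<sqinter> z, y \<sqinter> w) \<in> \<theta>"
    using assms unfolding lattice_congruence_def by meson+
qed

text \<open>If \<open>x\<close> and \<open>y\<close> are congruent and \<open>j\<close> is below \<open>x\<close> only, then meeting with \<open>j\<close> identifies \<open>j\<close>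
  with the strictly smaller meet of \<open>y\<close> and \<open>j\<close>. For the converse, induction on \<open>z\<close> below \<open>x\<close> shows that
  \<open>z\<close> is congruent to its meet with \<open>y\<close>: a proper join inherits this from its components, and a
  join-irreducible element not below \<open>y\<close> is in \<open>E\<close>, hence congruent to a smaller element.\<close>

lemma congruence_eq_cong_of:
  assumes cong: "lattice_congruence L \<theta>"
  defines "E \<equiv> {j \<in> J. \<exists>w\<in>carrier L. w \<sqsubseteq> j \<and> w \<noteq> j \<and> (w, j) \<in> \<theta>}"
  shows "\<theta> = cong_of E"
proof -
  note c = congruence_rules[OF cong]
  have sub: "below x - E \<subseteq> below y" if xy: "(x, y) \<in> \<theta>" for x y
  proof
    fix j assume j: "j \<in> below x - E"
    have jc: "j \<in> carrier L" "j \<sqsubseteq> x" "j \<in> J" using j J_carrier by (auto simp: below_def)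
    have xc: "x \<in> carrier L" "y \<in> carrier L" using c(1) xy by auto
    have "(y \<sqinter> j, j) \<in> \<theta>"
      using c(6)[OF c(3)[OF xy] c(2)[OF jc(1)]] meet_absorb[OF jc(1) xc(1) jc(2)] meet_comm[of L x j] by simp
    moreover have "y \<sqinter> j \<sqsubseteq> j" "y \<sqinter> j \<in> carrier L" using meet_right jc xc by auto
    ultimately have "y \<sqinter> j = j" using j jc unfolding E_def by blast
    then have "j \<sqsubseteq> y" using meet_left jc xc by metis
    then show "j \<in> below y" using jc by (simp add: below_def)
  qed
  \<comment> \<open>the claim is needed for \<open>z = x\<close>; ranging over all \<open>z\<close> below \<open>x\<close> makes the induction work\<close>
  have collapse: "(z \<sqinter> y, z) \<in> \<theta>"
    if xc: "x \<in> carrier L" "y \<in> carrier L" and xy: "below x - E \<subseteq> below y"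
      and "z \<in> carrier L" "z \<sqsubseteq> x" for x y z
    using that(4,5)
  proof (induction rule: le_induct)
    case (less z)
    have zy: "z \<sqinter> y \<in> carrier L" "z \<sqinter> y \<sqsubseteq> z" using less xc meet_left by auto
    consider "z \<sqsubseteq> y" | p q where "p \<in> carrier L" "q \<in> carrier L" "z = p \<squnion> q" "p \<noteq> z" "q \<noteq> z"
      | "z \<in> J" "\<not> z \<sqsubseteq> y"
      using less(1) xc unfolding join_irreducibles_def by blast
    then show ?case
    proof cases
      case 1
      then show ?thesis using meet_absorb less(1) xc c(2) by simp
    next
      case (2 p q)
      have pz: "p \<sqsubseteq> z" "q \<sqsubseteq> z" using 2 join_left join_right by auto
      have IH: "(p \<sqinter> y, p) \<in> \<theta>" "(q \<sqinter> y, q) \<in> \<theta>"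
        using less(2)[of p] less(2)[of q] 2 pz less(1,3) xc le_trans by blast+
      have "((p \<sqinter> y) \<squnion> (q \<sqinter> y), z) \<in> \<theta>" using c(5)[OF IH] 2 by simp
      from c(5)[OF this c(2)[OF zy(1)]]
      have "((p \<sqinter> y) \<squnion> (q \<sqinter> y) \<squnion> (z \<sqinter> y), z \<squnion> (z \<sqinter> y)) \<in> \<theta>" .
      moreover have "z \<squnion> (z \<sqinter> y) = z"
        using join_absorb[OF zy(1) less(1) zy(2)] join_comm[of L z] by simp
      moreover have "p \<sqinter> y \<sqsubseteq> z \<sqinter> y" "q \<sqinter> y \<sqsubseteq> z \<sqinter> y"
        using meet_mono pz 2 less(1) xc by simp_all
      then have "(p \<sqinter> y) \<squnion> (q \<sqinter> y) \<sqsubseteq> z \<sqinter> y" using join_le_iff 2 xc zy by simp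
      then have "(p \<sqinter> y) \<squnion> (q \<sqinter> y) \<squnion> (z \<sqinter> y) = z \<sqinter> y"
        using join_absorb 2 xc zy by simp
      ultimately show ?thesis by simp
    next
      case 3
      then have "z \<in> E" using xy less(3) unfolding below_def by blast
      then obtain w where w: "w \<in> carrier L" "w \<sqsubseteq> z" "w \<noteq> z" "(w, z) \<in> \<theta>"
        unfolding E_def by blast
      have "(w \<sqinter> y, w) \<in> \<theta>" using less(2)[of w] w less(1,3) xc le_trans by blast
      then have "(w \<sqinter> y, z) \<in> \<theta>" using c(4) w by blast
      from c(5)[OF this c(2)[OF zy(1)]]
      have "((w \<sqinter> y) \<squnion> (z \<sqinter> y), z \<squnion> (z \<sqinter> y)) \<in> \<theta>" .
      moreover have "z \<squnion> (z \<sqinter> y) = z"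
        using join_absorb[OF zy(1) less(1) zy(2)] join_comm[of L z] by simp
      moreover have "w \<sqinter> y \<sqsubseteq> z \<sqinter> y"
        using meet_mono w less(1) xc by simp
      then have "(w \<sqinter> y) \<squnion> (z \<sqinter> y) = z \<sqinter> y" using join_absorb w xc zy by simp
      ultimately show ?thesis by simp
    qed
  qed
  have "(x, y) \<in> \<theta> \<longleftrightarrow> (x, y) \<in> cong_of E" for x y
  proof
    assume xy: "(x, y) \<in> \<theta>"
    have "below x - E = below y - E" using sub[OF xy] sub[OF c(3)[OF xy]] by blast
    then show "(x, y) \<in> cong_of E" using c(1)[OF xy] by (simp add: cong_of_def)
  next
    assume "(x, y) \<in> cong_of E"
    then have xc: "x \<in> carrier L" "y \<in> carrier L" and eq: "below x - E = below y - E"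
      by (auto simp: cong_of_def)
    have "(x \<sqinter> y, x) \<in> \<theta>" "(y \<sqinter> x, y) \<in> \<theta>"
      using collapse[of x y x] collapse[of y x y] xc eq by auto
    then show "(x, y) \<in> \<theta>" using c(3,4) meet_comm[of L x y] by metis
  qed
  then show ?thesis by auto
qed

lemma cong_of_congruence:
  assumes "E \<in> admissible"
  shows "lattice_congruence L (cong_of E)"
proof -
  have eq: "equiv (carrier L) (cong_of E)"
    by (rule equivI) (auto simp: cong_of_def refl_on_def sym_def trans_def)
  have "(x \<squnion> z, y \<squnion> w) \<in> cong_of E \<and> (x \<sqinter> z, y \<sqinter> w) \<in> cong_of E"
    if "(x, y) \<in> cong_of E" "(z, w) \<in> cong_of E" for x y z w
  proof -
    have cs: "x \<in> carrier L" "y \<in> carrier L" "z \<in> carrier L" "w \<in> carrier L"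
      and e: "below x - E = below y - E" "below z - E = below w - E"
      using that by (auto simp: cong_of_def)
    have "below (x \<squnion> z) - E = below (y \<squnion> z) - E" "below (z \<squnion> y) - E = below (w \<squnion> y) - E"
      using assms cs e unfolding admissible_def by blast+
    then have "below (x \<squnion> z) - E = below (y \<squnion> w) - E"
      using join_comm[of L z y] join_comm[of L w y] by simp
    moreover have "below (x \<sqinter> z) - E = below (y \<sqinter> w) - E"
      using e below_meet cs by blast
    ultimately show ?thesis using cs by (simp add: cong_of_def)
  qed
  then show ?thesis using eq by (simp add: lattice_congruence_def)
qed

text \<open>The set \<open>E\<close> can be read off its relation: \<open>j\<close> is related to its lower cover exactly when \<open>j\<close> is
  in \<open>E\<close>.\<close>

lemma cong_of_subset_iff:
  assumes "E \<subseteq> J" "E' \<subseteq> J"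
  shows "cong_of E \<subseteq> cong_of E' \<longleftrightarrow> E \<subseteq> E'"
proof
  assume "E \<subseteq> E'"
  then show "cong_of E \<subseteq> cong_of E'" unfolding cong_of_def by blast
next
  assume sub: "cong_of E \<subseteq> cong_of E'"
  show "E \<subseteq> E'"
  proof
    fix j assume j: "j \<in> E"
    then have "j \<in> J" using assms by blast
    then obtain w where w: "w \<in> carrier L" "w \<sqsubseteq> j" "w \<noteq> j" "below w = below j - {j}"
      by (rule obtain_below_minus)
    have jc: "j \<in> carrier L" "j \<in> below j" using j assms J_carrier by (auto simp: below_def)
    have "(w, j) \<in> cong_of E" using w jc j by (auto simp: cong_of_def)
    then have "below w - E' = below j - E'" using sub by (auto simp: cong_of_def)
    then show "j \<in> E'" using w jc by blast
  qed
qed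

lemma bij_cong_of: "bij_betw cong_of admissible (carrier (Con L))"
proof -
  have adJ: "E \<subseteq> J" if "E \<in> admissible" for E using that by (auto simp: admissible_def)
  have inj: "inj_on cong_of admissible"
  proof (rule inj_onI)
    fix E E' assume *: "E \<in> admissible" "E' \<in> admissible" "cong_of E = cong_of E'"
    then show "E = E'" using cong_of_subset_iff[of E E'] cong_of_subset_iff[of E' E] adJ by auto
  qed
  have "\<theta> \<in> cong_of ` admissible" if cong: "lattice_congruence L \<theta>" for \<theta>
  proof -
    let ?E = "{j \<in> J. \<exists>w\<in>carrier L. w \<sqsubseteq> j \<and> w \<noteq> j \<and> (w, j) \<in> \<theta>}"
    note k = congruence_eq_cong_of[OF cong]
    have "?E \<in> admissible"
      unfolding admissible_def
    proof (intro CollectI conjI ballI impI)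
      fix x y z assume "x \<in> carrier L" "y \<in> carrier L" "z \<in> carrier L" "below x - ?E = below y - ?E"
      then have "(x, y) \<in> \<theta>" "(z, z) \<in> \<theta>" using k congruence_rules(2)[OF cong] by (auto simp: cong_of_def)
      then have "(x \<squnion> z, y \<squnion> z) \<in> cong_of ?E" using congruence_rules(5)[OF cong] k by metis
      then show "below (x \<squnion> z) - ?E = below (y \<squnion> z) - ?E" by (auto simp: cong_of_def)
    qed auto
    then show ?thesis using k by blast
  qed
  then show ?thesis using inj cong_of_congruence by (auto simp: bij_betw_def Con_def)
qed

section \<open>Join-reducible elements and the size of the lattice\<close>

definition reducibles :: "'a set" where
  "reducibles = {r. \<exists>x\<in>carrier L. \<exists>y\<in>carrier L. \<not> x \<sqsubseteq> y \<and> \<not> y \<sqsubseteq> x \<and> r = x \<squnion> y}"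

lemma reduciblesI:
  "x \<in> carrier L \<Longrightarrow> y \<in> carrier L \<Longrightarrow> \<not> x \<sqsubseteq> y \<Longrightarrow> \<not> y \<sqsubseteq> x \<Longrightarrow> x \<squnion> y \<in> reducibles"
  unfolding reducibles_def by blast

lemma reduciblesE:
  assumes "r \<in> reducibles"
  obtains x y where "x \<in> carrier L" "y \<in> carrier L" "\<not> x \<sqsubseteq> y" "\<not> y \<sqsubseteq> x" "r = x \<squnion> y"
    "x \<sqsubseteq> r" "y \<sqsubseteq> r" "r \<in> carrier L"
  using assms unfolding reducibles_def using join_left join_right by auto

lemma reducibles_carrier: "reducibles \<subseteq> carrier L"
  unfolding reducibles_def by auto

lemma obtain_bottom:
  assumes "carrier L \<noteq> {}"
  obtains b where "b \<in> carrier L" "\<And>x. x \<in> carrier L \<Longrightarrow> b \<sqsubseteq> x"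
proof -
  obtain b where b: "b \<in> carrier L" "\<And>z. z \<in> carrier L \<Longrightarrow> z \<sqsubseteq> b \<Longrightarrow> z = b"
    using obtain_minimal[OF order_refl assms] by metis
  have "b \<sqsubseteq> x" if "x \<in> carrier L" for x
    using b(2)[of "b \<sqinter> x"] meet_left[of b x] meet_right[of b x] b(1) that by simp
  then show ?thesis using that b(1) by blast
qed

lemma J_or_reducible:
  assumes "b \<in> carrier L" "\<And>x. x \<in> carrier L \<Longrightarrow> b \<sqsubseteq> x" "x \<in> carrier L" "x \<noteq> b" "x \<notin> reducibles"
  shows "x \<in> J"
  unfolding join_irreducibles_def
proof (intro CollectI conjI ballI impI)
  show "\<exists>y\<in>carrier L. \<not> x \<sqsubseteq> y" using assms le_antisym by blast
  fix p q assume pq: "p \<in> carrier L" "q \<in> carrier L" "p \<squnion> q = x"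
  then have "p \<sqsubseteq> q \<or> q \<sqsubseteq> p" using reduciblesI assms(5) by blast
  then show "p = x \<or> q = x" using pq join_absorb join_comm[of L p q] by metis
qed (use assms in auto)

text \<open>The three summands count join-irreducibles, joins of incomparable elements, and the bottom.\<close>

lemma card_carrier:
  assumes "carrier L \<noteq> {}"
  shows "card (carrier L) = card J + card reducibles + 1"
proof -
  obtain b where b: "b \<in> carrier L" "\<And>x. x \<in> carrier L \<Longrightarrow> b \<sqsubseteq> x"
    using obtain_bottom[OF assms] by metis
  have JR: "J \<inter> reducibles = {}"
  proof (rule ccontr)
    assume "J \<inter> reducibles \<noteq> {}"
    then obtain r where r: "r \<in> J" "r \<in> reducibles" by blast
    from r(2) obtain x y where xy: "x \<in> carrier L" "y \<in> carrier L" "\<not> x \<sqsubseteq> y" "\<not> y \<sqsubseteq> x"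
      "r = x \<squnion> y" "x \<sqsubseteq> r" "y \<sqsubseteq> r" by (rule reduciblesE)
    have "x = x \<squnion> y \<or> y = x \<squnion> y" using J_joinD r(1) xy by blast
    then show False using xy by metis
  qed
  have bJ: "b \<notin> J" using b by (auto simp: join_irreducibles_def)
  have bR: "b \<notin> reducibles"
  proof
    assume "b \<in> reducibles"
    then obtain x y where xy: "x \<in> carrier L" "y \<in> carrier L" "\<not> x \<sqsubseteq> y" "x \<sqsubseteq> b"
      by (rule reduciblesE)
    then show False using b le_trans by blast
  qed
  have "carrier L = insert b (J \<union> reducibles)"
    using J_or_reducible[OF b] b(1) reducibles_carrier J_carrier by blast
  moreover have "finite reducibles" using reducibles_carrier finite_carrier finite_subset by blast
  ultimately show ?thesis using bJ bR JR finite_J by (simp add: card_Un_disjoint)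
qed

lemma card_ge_4_if_reducible:
  assumes "reducibles \<noteq> {}"
  shows "card (carrier L) \<ge> 4"
proof -
  obtain r where "r \<in> reducibles" using assms by blast
  then obtain x y where xy: "x \<in> carrier L" "y \<in> carrier L" "\<not> x \<sqsubseteq> y" "\<not> y \<sqsubseteq> x"
    "x \<sqsubseteq> r" "y \<sqsubseteq> r" "r \<in> carrier L" by (rule reduciblesE)
  have m: "x \<sqinter> y \<in> carrier L" "x \<sqinter> y \<sqsubseteq> x" "x \<sqinter> y \<sqsubseteq> y" using meet_left meet_right xy by auto
  have "\<not> r \<sqsubseteq> x" using le_trans[of y r x] xy by blast
  then have "distinct [x \<sqinter> y, x, y, r]" using xy m by auto
  then have "card {x \<sqinter> y, x, y, r} = 4" by auto
  then show ?thesis using card_mono[OF finite_carrier, of "{x \<sqinter> y, x, y, r}"] xy m by simp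
qed

text \<open>Two join-reducible elements may be taken comparable, \<open>u\<close> below \<open>w\<close>, by replacing one of two
  incomparable ones with their join. If \<open>u\<close> is the join of \<open>x\<close> and \<open>y\<close>, then \<open>x\<close> and \<open>y\<close> are the only
  incomparable pair among \<open>u\<close>, \<open>w\<close>, \<open>x\<close>, \<open>y\<close> and the meet of \<open>x\<close> and \<open>y\<close>, and their join is not \<open>w\<close>; so \<open>w\<close>
  needs a sixth element.\<close>

lemma card_ge_6_if_two_reducibles:
  assumes "card reducibles \<ge> 2"
  shows "card (carrier L) \<ge> 6"
proof -
  obtain T where "T \<subseteq> reducibles" "card T = 2"
    using obtain_subset_with_card_n[OF assms] by metis
  then obtain r s where rs: "r \<in> reducibles" "s \<in> reducibles" "r \<noteq> s"
    by (auto simp: card_2_iff)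
  have rsc: "r \<in> carrier L" "s \<in> carrier L" using rs reducibles_carrier by auto
  have "\<exists>u w. u \<in> reducibles \<and> w \<in> reducibles \<and> u \<sqsubseteq> w \<and> u \<noteq> w"
  proof (cases "r \<sqsubseteq> s \<or> s \<sqsubseteq> r")
    case True
    then show ?thesis using rs by metis
  next
    case False
    then have "r \<squnion> s \<in> reducibles" "r \<sqsubseteq> r \<squnion> s" "r \<noteq> r \<squnion> s"
      using reduciblesI[of r s] rsc join_left[of r s] join_right[of r s] by auto
    then show ?thesis using rs by blast
  qed
  then obtain u w where uw: "u \<in> reducibles" "w \<in> reducibles" "u \<sqsubseteq> w" "u \<noteq> w" by blast
  obtain x y where xy: "x \<in> carrier L" "y \<in> carrier L" "\<not> x \<sqsubseteq> y" "\<not> y \<sqsubseteq> x" "u = x \<squnion> y"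
    "x \<sqsubseteq> u" "y \<sqsubseteq> u" "u \<in> carrier L" using uw(1) by (rule reduciblesE)
  obtain p q where pq: "p \<in> carrier L" "q \<in> carrier L" "\<not> p \<sqsubseteq> q" "\<not> q \<sqsubseteq> p" "w = p \<squnion> q"
    "p \<sqsubseteq> w" "q \<sqsubseteq> w" "w \<in> carrier L" using uw(2) by (rule reduciblesE)
  have m: "x \<sqinter> y \<in> carrier L" "x \<sqinter> y \<sqsubseteq> x" "x \<sqinter> y \<sqsubseteq> y"
    using meet_left meet_right xy by auto
  then have mu: "x \<sqinter> y \<sqsubseteq> u" using le_trans[of "x \<sqinter> y" x u] xy by blast
  have ux: "\<not> u \<sqsubseteq> x" using le_trans[of y u x] xy by blast
  have wu: "\<not> w \<sqsubseteq> u" using uw xy(8) pq(8) le_antisym by blast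
  let ?D = "{x \<sqinter> y, x, y, u, w}"
  have "distinct [x \<sqinter> y, x, y, u, w]" using xy(1,3,4,6,7) m mu wu ux uw(4) by auto
  then have 5: "card ?D = 5" by auto
  have "\<not> {p, q} \<subseteq> ?D"
  proof
    assume "{p, q} \<subseteq> ?D"
    moreover have "p \<noteq> w" "q \<noteq> w" using pq by auto
    ultimately have "p \<in> {x \<sqinter> y, x, y, u}" "q \<in> {x \<sqinter> y, x, y, u}" by auto
    then have "{p, q} = {x, y}" using pq(1,3,4) xy(6-8) m mu by auto
    then have "p \<squnion> q = x \<squnion> y" using join_comm[of L x y] by (metis doubleton_eq_iff)
    then show False using uw xy pq by simp
  qed
  then obtain t where t: "t \<in> carrier L" "t \<notin> ?D" using pq by auto
  then have "card (insert t ?D) = 6" using 5 by simp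
  then show ?thesis using card_mono[OF finite_carrier, of "insert t ?D"] xy m pq t by simp
qed

section \<open>Admissible sets when at most one element is join-reducible\<close>

lemma below_join:
  assumes "x \<in> carrier L" "y \<in> carrier L" "x \<sqsubseteq> y \<or> y \<sqsubseteq> x"
  shows "below (x \<squnion> y) = below x \<union> below y"
  using assms(3)
proof
  assume "x \<sqsubseteq> y"
  then show ?thesis using assms join_absorb[of x y] below_mono[of x y] by (simp add: Un_absorb1)
next
  assume "y \<sqsubseteq> x"
  then show ?thesis using assms join_absorb[of y x] below_mono[of y x] join_comm[of L x y]
    by (simp add: Un_absorb2)
qed

lemma admissible_subset_Pow: "admissible \<subseteq> Pow J"
  by (auto simp: admissible_def)

lemma card_admissible_le: "card admissible \<le> 2 ^ card J"
  using card_mono[OF _ admissible_subset_Pow] finite_J by (simp add: card_Pow)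

lemma admissible_eq_Pow_if_card:
  assumes "card admissible = 2 ^ card J"
  shows "admissible = Pow J"
  by (rule card_subset_eq) (use assms finite_J admissible_subset_Pow in \<open>auto simp: card_Pow\<close>)

lemma admissibleD:
  assumes "E \<in> admissible" "x \<in> carrier L" "y \<in> carrier L" "z \<in> carrier L"
    "below x - E = below y - E"
  shows "below (x \<squnion> z) - E = below (y \<squnion> z) - E"
  using assms unfolding admissible_def by blast

text \<open>Joins can fail to be respected only at a join-irreducible \<open>t\<close> outside \<open>E\<close> that lies below a join without
  lying below either component. The condition asks both components of such a join to be
  join-irreducible and outside \<open>E\<close> (the second one by exchanging the roles of \<open>x\<close> and \<open>z\<close>); an
  element related to \<open>x\<close> is then above \<open>x\<close>, so \<open>t\<close> is below the other join as well.\<close>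

lemma admissibleI:
  assumes "E \<subseteq> J"
    and "\<And>x z t. x \<in> carrier L \<Longrightarrow> z \<in> carrier L \<Longrightarrow> t \<in> below (x \<squnion> z) \<Longrightarrow> t \<notin> below x \<Longrightarrow>
      t \<notin> below z \<Longrightarrow> t \<notin> E \<Longrightarrow> x \<in> J - E"
  shows "E \<in> admissible"
proof -
  have sub: "below (x \<squnion> z) - E \<subseteq> below (y \<squnion> z)"
    if c: "x \<in> carrier L" "y \<in> carrier L" "z \<in> carrier L" and e: "below x - E = below y - E" for x y z
  proof
    fix t assume t: "t \<in> below (x \<squnion> z) - E"
    have up: "below y \<union> below z \<subseteq> below (y \<squnion> z)"
      using below_mono[OF c(2) _ join_left[OF c(2,3)]] below_mono[OF c(3) _ join_right[OF c(2,3)]] c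
      by simp
    show "t \<in> below (y \<squnion> z)"
    proof (cases "t \<in> below x \<union> below z")
      case True
      then show ?thesis using t e up by blast
    next
      case False
      then have "x \<in> J - E" using assms(2)[of x z t] c t by blast
      then have "x \<in> below y" using e c(1) by (auto simp: below_def)
      then have "x \<sqsubseteq> y" by (simp add: below_def)
      then have "x \<squnion> z \<sqsubseteq> y \<squnion> z" using join_mono c by blast
      then show ?thesis using below_mono[of "x \<squnion> z" "y \<squnion> z"] c t by auto
    qed
  qed
  show ?thesis
    unfolding admissible_def
  proof (intro CollectI conjI ballI impI)
    fix x y z assume c: "x \<in> carrier L" "y \<in> carrier L" "z \<in> carrier L" "below x - E = below y - E"
    show "below (x \<squnion> z) - E = below (y \<squnion> z) - E"
      using sub[OF c] sub[OF c(2,1,3) c(4)[symmetric]] by blast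
  qed (rule assms(1))
qed

lemma admissible_eq_Pow:
  assumes "\<And>x y. x \<in> carrier L \<Longrightarrow> y \<in> carrier L \<Longrightarrow> below (x \<squnion> y) \<subseteq> below x \<union> below y"
  shows "admissible = Pow J"
proof
  show "Pow J \<subseteq> admissible"
  proof
    fix E assume "E \<in> Pow J"
    then show "E \<in> admissible" using assms by (intro admissibleI) auto
  qed
qed (rule admissible_subset_Pow)

text \<open>Here \<open>x\<close> plays the lower cover of \<open>a\<close>. Collapsing \<open>a\<close> onto \<open>x\<close> and joining with an element \<open>z\<close> above \<open>x\<close>
  collapses the whole interval from \<open>z\<close> up to the join of \<open>a\<close> and \<open>z\<close>.\<close>

lemma collapse_spreads:
  assumes "E \<in> admissible" "x \<in> carrier L" "a \<in> carrier L" "z \<in> carrier L"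
    and "below a \<subseteq> insert a (below x)" "below x \<subseteq> below a" "x \<sqsubseteq> z" "a \<in> E"
  shows "below (a \<squnion> z) - below z \<subseteq> E"
proof -
  have "below x - E = below a - E" using assms by blast
  then have "below (x \<squnion> z) - E = below (a \<squnion> z) - E" using admissibleD assms by blast
  then show ?thesis using join_absorb assms by auto
qed

text \<open>The three cases follow the size of the set \<open>C\<close> of join-irreducibles below \<open>u\<close> that are below
  neither of two suitably minimal incomparable elements \<open>a\<close> and \<open>b\<close>; any two incomparable elements
  belong to \<open>{a, b} \<union> C\<close>.

  If \<open>C\<close> is empty, joins create no new join-irreducibles and every set is admissible. If \<open>C = {c}\<close>
  with \<open>c\<close> above \<open>a\<close> or \<open>b\<close>, then \<open>a\<close>, \<open>b\<close>, \<open>c\<close> are the inner elements of a pentagon, and only the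
  join of \<open>a\<close> and \<open>b\<close> creates a new one, namely \<open>c\<close>. If \<open>c\<close> is incomparable to both, they are the
  inner elements of a diamond: admissible sets leave at most 3 of the 8 traces on \<open>{a, b, c}\<close>. If \<open>C\<close>
  has two elements \<open>c\<close> and \<open>d\<close>, at most 7 of the 16 traces on \<open>{a, b, c, d}\<close> remain.\<close>

lemma one_reducible_trichotomy:
  assumes R: "reducibles = {u}"
  shows "admissible = Pow J \<or>
    (\<exists>a b c. {a, b, c} \<subseteq> J \<and> distinct [a, b, c] \<and> admissible = tied_sets J a b c) \<or>
    2 * card admissible < 2 ^ card J"
proof -
  have uc: "u \<in> carrier L" using reduciblesE[of u] R by blast
  then obtain bt where bt: "bt \<in> carrier L" "\<And>x. x \<in> carrier L \<Longrightarrow> bt \<sqsubseteq> x"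
    using obtain_bottom by blast
  have join_u: "x \<squnion> y = u" if "x \<in> carrier L" "y \<in> carrier L" "\<not> x \<sqsubseteq> y" "\<not> y \<sqsubseteq> x" for x y
    using reduciblesI[OF that] R by simp
  define A where "A = {x \<in> carrier L. \<exists>y\<in>carrier L. \<not> x \<sqsubseteq> y \<and> \<not> y \<sqsubseteq> x}"
  have "u \<in> reducibles" using R by simp
  then obtain x0 y0 where "x0 \<in> carrier L" "y0 \<in> carrier L" "\<not> x0 \<sqsubseteq> y0" "\<not> y0 \<sqsubseteq> x0"
    by (rule reduciblesE)
  then have "x0 \<in> A" unfolding A_def by blast
  then obtain a where a: "a \<in> A" "\<And>z. z \<in> A \<Longrightarrow> z \<sqsubseteq> a \<Longrightarrow> z = a"
    using obtain_minimal[of A] A_def by (metis (no_types, lifting) empty_iff mem_Collect_eq subsetI)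
  define B where "B = {y \<in> carrier L. \<not> a \<sqsubseteq> y \<and> \<not> y \<sqsubseteq> a}"
  have "B \<noteq> {}" using a(1) unfolding A_def B_def by blast
  then obtain b where b: "b \<in> B" "\<And>z. z \<in> B \<Longrightarrow> z \<sqsubseteq> b \<Longrightarrow> z = b"
    using obtain_minimal[of B] B_def by (metis (no_types, lifting) mem_Collect_eq subsetI)
  have ac: "a \<in> carrier L" "b \<in> carrier L" and ab: "\<not> a \<sqsubseteq> b" "\<not> b \<sqsubseteq> a"
    using a b unfolding A_def B_def by auto
  have small: "z \<sqsubseteq> y \<or> y \<sqsubseteq> z" if "z \<in> carrier L" "z \<sqsubseteq> a" "z \<noteq> a" "y \<in> carrier L" for z y
    using a(2)[of z] that unfolding A_def by blast
  \<comment> \<open>by minimality \<open>a\<close> and \<open>b\<close> have the same strict lower bounds, the largest being \<open>v\<close>\<close>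
  have below_a_b: "z \<sqsubseteq> b" if "z \<in> carrier L" "z \<sqsubseteq> a" "z \<noteq> a" for z
    using small[OF that ac(2)] that le_trans[of b z a] ab ac by blast
  have below_b_a: "z \<sqsubseteq> a" if "z \<in> carrier L" "z \<sqsubseteq> b" "z \<noteq> b" for z
    using b(2)[of z] that le_trans[of a z b] ab ac unfolding B_def by blast
  have u: "a \<squnion> b = u" using join_u ac ab by blast
  have le_u: "a \<sqsubseteq> u" "b \<sqsubseteq> u" using join_left join_right ac u by auto
  have aJ: "a \<in> J"
    by (rule J_or_reducible[OF bt ac(1)]) (use bt R le_u ab ac in auto)
  have bJ: "b \<in> J"
    by (rule J_or_reducible[OF bt ac(2)]) (use bt R le_u ab ac in auto)
  define v where "v = a \<sqinter> b"
  have vc: "v \<in> carrier L" "v \<sqsubseteq> a" "v \<sqsubseteq> b" using ac meet_left meet_right unfolding v_def by auto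
  have va: "v \<noteq> a" using vc(3) ab by blast
  have below_v: "below v = below a \<inter> below b" unfolding v_def using below_meet ac by blast
  have in_below: "a \<in> below a" "b \<in> below b" "a \<notin> below b" "b \<notin> below a"
    using aJ bJ ab ac by (auto simp: below_def)
  have below_a: "below a \<subseteq> insert a (below v)"
    unfolding below_v using below_a_b J_carrier by (auto simp: below_def)
  have below_b: "below b \<subseteq> insert b (below v)"
    unfolding below_v using below_b_a J_carrier by (auto simp: below_def)
  have below_va: "below v \<subseteq> below a" "below v \<subseteq> below b" using below_v by auto
  have a_v: "below v \<subseteq> {z. z \<sqsubseteq> a \<and> z \<noteq> a}" using below_v in_below by (auto simp: below_def)
  define C where "C = below u - (below a \<union> below b)"
  have below_u: "below u = below a \<union> below b \<union> C"
    using below_mono ac uc le_u unfolding C_def by blast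
  have CJ: "C \<subseteq> J" unfolding C_def using below_J by blast
  have abC: "a \<notin> C" "b \<notin> C" using in_below unfolding C_def by auto
  \<comment> \<open>collapsing \<open>a\<close> onto \<open>v\<close> collapses \<open>u\<close> onto \<open>b\<close>, and symmetrically\<close>
  have forced: "C \<subseteq> E" if E: "E \<in> admissible" and "a \<in> E \<or> b \<in> E" for E
    using that(2)
  proof
    assume "a \<in> E"
    then have "below (a \<squnion> b) - below b \<subseteq> E"
      by (rule collapse_spreads[OF E vc(1) ac below_a below_va(1) vc(3)])
    then show ?thesis unfolding u C_def by blast
  next
    assume "b \<in> E"
    then have "below (b \<squnion> a) - below a \<subseteq> E"
      by (rule collapse_spreads[OF E vc(1) ac(2,1) below_b below_va(2) vc(2)])
    then show ?thesis unfolding u join_comm[of L b a] C_def by blast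
  qed
  have incomp: "x \<in> insert a (insert b C)"
    if xy: "x \<in> carrier L" "y \<in> carrier L" "\<not> x \<sqsubseteq> y" "\<not> y \<sqsubseteq> x" for x y
  proof -
    have xu: "x \<sqsubseteq> u" "y \<sqsubseteq> u" using join_u[OF xy] join_left join_right xy by metis+
    have "x \<in> J" by (rule J_or_reducible[OF bt xy(1)]) (use bt R xu xy in auto)
    then have "x \<in> below u" using xu by (simp add: below_def)
    moreover have "x \<notin> below v" using a_v small xy by blast
    ultimately show ?thesis using below_u below_a below_b xu by blast
  qed
  consider "C = {}" | c where "C = {c}" | c d where "c \<in> C" "d \<in> C" "c \<noteq> d" by blast
  then show ?thesis
  proof cases
    case 1
    have "admissible = Pow J"
    proof (rule admissible_eq_Pow)
      fix x y assume xy: "x \<in> carrier L" "y \<in> carrier L"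
      show "below (x \<squnion> y) \<subseteq> below x \<union> below y"
      proof (cases "x \<sqsubseteq> y \<or> y \<sqsubseteq> x")
        case True
        then show ?thesis using below_join xy by blast
      next
        case False
        then have "x \<in> {a, b}" "y \<in> {a, b}" using incomp[of x y] incomp[of y x] xy 1 by auto
        then have "below x \<union> below y = below a \<union> below b" using False xy by auto
        then show ?thesis using join_u[of x y] xy False below_u 1 by auto
      qed
    qed
    then show ?thesis by blast
  next
    case (2 c)
    have cJ: "c \<in> J" "c \<in> carrier L" "c \<noteq> a" "c \<noteq> b"
      and cab: "\<not> c \<sqsubseteq> a" "\<not> c \<sqsubseteq> b"
      using 2 CJ J_carrier abC below_u C_def by (auto simp: below_def)
    have dist: "distinct [a, b, c]" using cJ ab ac by auto
    show ?thesis
    proof (cases "a \<sqsubseteq> c \<or> b \<sqsubseteq> c")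
      case True
      have "admissible = tied_sets J a b c"
      proof
        show "admissible \<subseteq> tied_sets J a b c"
          using forced 2 admissible_subset_Pow unfolding tied_sets_def by blast
        show "tied_sets J a b c \<subseteq> admissible"
        proof
          fix E assume E: "E \<in> tied_sets J a b c"
          show "E \<in> admissible"
          proof (rule admissibleI)
            show "E \<subseteq> J" using E by (auto simp: tied_sets_def)
            fix x z t assume t: "x \<in> carrier L" "z \<in> carrier L" "t \<in> below (x \<squnion> z)"
              "t \<notin> below x" "t \<notin> below z" "t \<notin> E"
            then have nc: "\<not> x \<sqsubseteq> z" "\<not> z \<sqsubseteq> x" using below_join by blast+
            have xz: "x \<in> {a, b, c}" "z \<in> {a, b, c}"
              using incomp[OF t(1,2) nc] incomp[OF t(2,1) nc(2,1)] 2 by auto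
            have tu: "t \<in> below u" using t join_u nc by metis
            \<comment> \<open>joining with \<open>c\<close> creates nothing new, since \<open>c\<close> is above \<open>a\<close> or \<open>b\<close>\<close>
            have "c \<notin> {x, z}"
            proof
              assume c: "c \<in> {x, z}"
              then have "(a \<in> {x, z} \<and> b \<sqsubseteq> c) \<or> (b \<in> {x, z} \<and> a \<sqsubseteq> c)"
                using xz nc True t(1) by auto
              then have "below a \<union> below b \<subseteq> below x \<union> below z"
                using c below_mono[of a c] below_mono[of b c] ac cJ(2) by auto
              moreover have "c \<in> below x \<union> below z" using c cJ by (auto simp: below_def)
              ultimately show False using tu t(4,5) below_u 2 by blast
            qed
            then have xz': "{x, z} = {a, b}" using xz nc t(1) by auto
            then have "below x \<union> below z = below a \<union> below b" by (auto simp: doubleton_eq_iff)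
            then have "t = c" using tu t(4,5) below_u 2 by blast
            then show "x \<in> J - E" using E t(6) xz xz' aJ bJ by (auto simp: tied_sets_def)
          qed
        qed
      qed
      then show ?thesis using dist cJ aJ bJ by blast
    next
      case False
      \<comment> \<open>the diamond: \<open>v\<close> is the lower cover of \<open>a\<close>, \<open>b\<close> and \<open>c\<close>, and any two of them join to \<open>u\<close>\<close>
      have vcc: "v \<sqsubseteq> c"
        using small[OF vc(1,2) va cJ(2)] le_trans[of c v a] cab vc ac cJ by blast
      have join_c: "a \<squnion> c = u" "b \<squnion> c = u" using join_u False cab ac cJ by blast+
      have ac': "below u - below c \<subseteq> E" if "E \<in> admissible" "a \<in> E" for E
        using collapse_spreads[OF that(1) vc(1) ac(1) cJ(2) below_a below_va(1) vcc that(2)] join_c by simp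
      have bc': "below u - below c \<subseteq> E" if "E \<in> admissible" "b \<in> E" for E
        using collapse_spreads[OF that(1) vc(1) ac(2) cJ(2) below_b below_va(2) vcc that(2)] join_c by simp
      have "a \<notin> below c" "b \<notin> below c" using False by (auto simp: below_def)
      then have E: "a \<in> E \<longleftrightarrow> b \<in> E" "a \<in> E \<Longrightarrow> c \<in> E" if "E \<in> admissible" for E
        using ac' bc' forced that 2 below_u in_below by blast+
      let ?H = "{{}, {c}, {a, b, c}}"
      have "2 * card admissible < 2 ^ card J"
      proof (rule card_less_half_if_trace[OF finite_J])
        show "E \<inter> {a, b, c} \<in> ?H" if "E \<in> admissible" for E
          using E[OF that] by (cases "a \<in> E"; cases "c \<in> E") auto
        have "card ?H \<le> 3" using card_length[of "[{}, {c}, {a, b, c}]"] by simp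
        then show "2 * card ?H < 2 ^ card {a, b, c}" using dist by simp
      qed (use cJ aJ bJ admissible_subset_Pow in auto)
      then show ?thesis by blast
    qed
  next
    case (3 c d)
    have cd: "c \<in> J" "d \<in> J" "distinct [a, b, c, d]" using 3 CJ abC ab ac by auto
    have E: "c \<in> E \<and> d \<in> E" if "E \<in> admissible" "a \<in> E \<or> b \<in> E" for E
      using forced that 3 by blast
    let ?H = "{{}, {c}, {d}, {c, d}, {a, c, d}, {b, c, d}, {a, b, c, d}}"
    have "2 * card admissible < 2 ^ card J"
    proof (rule card_less_half_if_trace[OF finite_J])
      show "E \<inter> {a, b, c, d} \<in> ?H" if "E \<in> admissible" for E
        using E[OF that] by (cases "a \<in> E"; cases "b \<in> E"; cases "c \<in> E"; cases "d \<in> E") auto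
      have "card ?H \<le> 7" using card_length[of "[{}, {c}, {d}, {c, d}, {a, c, d}, {b, c, d}, {a, b, c, d}]"] by simp
      then show "2 * card ?H < 2 ^ card {a, b, c, d}" using cd(3) by simp
    qed (use cd aJ bJ admissible_subset_Pow in auto)
    then show ?thesis by blast
  qed
qed

lemma admissible_chain:
  assumes "reducibles = {}"
  shows "admissible = Pow J"
proof (rule admissible_eq_Pow)
  fix x y assume "x \<in> carrier L" "y \<in> carrier L"
  moreover from this have "x \<sqsubseteq> y \<or> y \<sqsubseteq> x" using reduciblesI assms by blast
  ultimately show "below (x \<squnion> y) \<subseteq> below x \<union> below y" using below_join by blast
qed

section \<open>The shape of the congruence lattice\<close>

lemma represents_Con: "represents admissible (Con L) cong_of"
  unfolding represents_def using bij_cong_of cong_of_subset_iff admissible_subset_Pow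
  by (auto simp: Con_def)

lemma Con_Boolean:
  assumes "admissible = Pow J"
  shows "Con L \<cong>\<^sub>l \<L>\<^sub>2 [^]\<^sub>l card J"
proof -
  obtain e where e: "bij_betw e {..<card J} J"
    using ex_bij_betw_nat_finite[OF finite_J] by (auto simp: lessThan_atLeast0)
  show ?thesis
    by (rule isomorphic_if_represents[OF _ represents_Con, unfolded assms, OF _ represents_Pow[OF e]]) auto
qed

lemma Con_tied:
  assumes "admissible = tied_sets J a b c" and abc: "{a, b, c} \<subseteq> J" "distinct [a, b, c]"
  shows "Con L \<cong>\<^sub>l \<L>\<^sub>2 [^]\<^sub>l (card J - 3) \<times>\<^sub>l (\<L>\<^sub>2 \<dotplus>\<^sub>l \<L>\<^sub>2 [^]\<^sub>l 2)"
proof -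
  have "card (J - {a, b, c}) = card J - 3" using abc finite_J by (simp add: card_Diff_subset)
  then obtain e where e: "bij_betw e {..<card J - 3} (J - {a, b, c})"
    using ex_bij_betw_nat_finite[of "J - {a, b, c}"] finite_J by (auto simp: lessThan_atLeast0)
  show ?thesis
    by (rule isomorphic_if_represents[OF _ represents_Con, unfolded assms(1), OF _ represents_tied_sets[OF e abc]])
      (auto simp: tied_sets_def)
qed

end

text \<open>Clears the denominators, as the exponents may be negative.\<close>

lemma of_nat_eq_powi_iff:
  "of_nat k = of_nat q * (2::rat) powi (int n - int c) \<longleftrightarrow> k * 2 ^ c = q * 2 ^ n"
proof -
  let ?d = "(2::rat) powi (int n - int c)"
  have d: "?d * 2 ^ c = 2 ^ n" by (simp add: power_int_diff)
  have "of_nat k = of_nat q * ?d \<longleftrightarrow> of_nat k * 2 ^ c = of_nat q * ?d * (2::rat) ^ c" by simp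
  also have "\<dots> \<longleftrightarrow> of_nat k * 2 ^ c = of_nat q * (2::rat) ^ n" by (simp only: mult.assoc d)
  also have "\<dots> \<longleftrightarrow> of_nat (k * 2 ^ c) = (of_nat (q * 2 ^ n) :: rat)" by simp
  finally show ?thesis using of_nat_eq_iff by blast
qed

theorem corollary5p8:
  fixes n :: nat and L :: "('a, 'm) gorder_scheme"
  assumes "n > 0" and "lattice L" and "card (carrier L) = n"
  shows "(of_nat (card (carrier (Con L))) = (2::rat) powi (int n - 1)
            \<longrightarrow> Con L \<cong>\<^sub>l \<L>\<^sub>2 [^]\<^sub>l (n - 1)) \<and>
         (of_nat (card (carrier (Con L))) = (2::rat) powi (int n - 2)
            \<longrightarrow> n \<ge> 4 \<and> Con L \<cong>\<^sub>l \<L>\<^sub>2 [^]\<^sub>l (n - 2)) \<and>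
         (of_nat (card (carrier (Con L))) = 5 * (2::rat) powi (int n - 5)
            \<longrightarrow> n \<ge> 5 \<and> Con L \<cong>\<^sub>l \<L>\<^sub>2 [^]\<^sub>l (n - 5) \<times>\<^sub>l (\<L>\<^sub>2 \<dotplus>\<^sub>l \<L>\<^sub>2 [^]\<^sub>l 2)) \<and>
         (of_nat (card (carrier (Con L))) = (2::rat) powi (int n - 3)
            \<longrightarrow> n \<ge> 6 \<and> Con L \<cong>\<^sub>l \<L>\<^sub>2 [^]\<^sub>l (n - 3))"
proof -
  interpret lattice L by (rule assms)
  interpret finite_lattice L
    by unfold_locales (use assms in \<open>simp add: card_ge_0_finite\<close>)
  define k where "k = card (carrier (Con L))"
  define j where "j = card J"
  define r where "r = card reducibles"
  have k: "k = card admissible" unfolding k_def using bij_betw_same_card[OF bij_cong_of] by simp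
  have n: "n = j + r + 1"
    unfolding j_def r_def using card_carrier assms(1,3) by fastforce
  have le: "k \<le> 2 ^ j" unfolding k j_def by (rule card_admissible_le)
  have Boolean: "Con L \<cong>\<^sub>l \<L>\<^sub>2 [^]\<^sub>l j" if "k = 2 ^ j"
    unfolding j_def by (rule Con_Boolean, rule admissible_eq_Pow_if_card) (use that k j_def in simp)
  have fin: "finite reducibles" using reducibles_carrier finite_carrier finite_subset by blast
  have r0: "k = 2 ^ j" if "r = 0"
    using that admissible_chain fin finite_J by (simp add: r_def k j_def card_Pow)
  have n4: "n \<ge> 4" if "r \<noteq> 0" using that card_ge_4_if_reducible assms(3) r_def by fastforce
  have n6: "n \<ge> 6" if "r \<ge> 2" using that card_ge_6_if_two_reducibles assms(3) by (auto simp: r_def)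
  have r1: "k = 2 ^ j \<or> (j \<ge> 3 \<and> k = 5 * 2 ^ (j - 3) \<and>
      Con L \<cong>\<^sub>l \<L>\<^sub>2 [^]\<^sub>l (j - 3) \<times>\<^sub>l (\<L>\<^sub>2 \<dotplus>\<^sub>l \<L>\<^sub>2 [^]\<^sub>l 2)) \<or> 2 * k < 2 ^ j" if r: "r = 1"
  proof -
    obtain u where "reducibles = {u}" using r card_1_singletonE[of reducibles] unfolding r_def by blast
    from one_reducible_trichotomy[OF this] show ?thesis
    proof (elim disjE exE conjE)
      assume "admissible = Pow J"
      then show ?thesis using finite_J by (simp add: k j_def card_Pow)
    next
      fix a b c assume abc: "{a, b, c} \<subseteq> J" "distinct [a, b, c]" "admissible = tied_sets J a b c"
      have "card {a, b, c} = 3" using abc(2) by simp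
      then have "j \<ge> 3" using card_mono[OF finite_J abc(1)] j_def by simp
      then show ?thesis using Con_tied[OF abc(3,1,2)] card_tied_sets[OF finite_J abc(1,2)] abc(3) k j_def by simp
    qed (simp add: k j_def)
  qed
  have pos: "(2::nat) ^ n > 0" by simp
  have nonchain: "r \<noteq> 0" if "2 * k \<noteq> 2 ^ n"
  proof
    assume "r = 0"
    then have "k = 2 ^ j" "n = j + 1" using r0 n by auto
    then show False using that by simp
  qed
  have 1: "Con L \<cong>\<^sub>l \<L>\<^sub>2 [^]\<^sub>l (n - 1)" if "k * 2 = 2 ^ n"
  proof -
    have "(2::nat) ^ n \<le> 2 ^ (j + 1)" using that le by simp
    then have "n \<le> j + 1" by (rule power_le_imp_le_exp[rotated]) simp
    then have "r = 0" using n by simp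
    then show ?thesis using Boolean r0 n by simp
  qed
  have 2: "n \<ge> 4 \<and> Con L \<cong>\<^sub>l \<L>\<^sub>2 [^]\<^sub>l (n - 2)" if *: "k * 4 = 2 ^ n"
  proof -
    have "(2::nat) ^ n \<le> 2 ^ (j + 2)" using * le by simp
    then have "n \<le> j + 2" by (rule power_le_imp_le_exp[rotated]) simp
    moreover have "r \<noteq> 0" by (rule nonchain) (use * pos in linarith)
    ultimately have "r = 1" using n by simp
    then show ?thesis using Boolean n4 * n by simp
  qed
  have 3: "n \<ge> 5 \<and> Con L \<cong>\<^sub>l \<L>\<^sub>2 [^]\<^sub>l (n - 5) \<times>\<^sub>l (\<L>\<^sub>2 \<dotplus>\<^sub>l \<L>\<^sub>2 [^]\<^sub>l 2)" if *: "k * 32 = 5 * 2 ^ n"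
  proof -
    \<comment> \<open>five exceeds four, so already \<open>n + 2 < j + 5\<close>\<close>
    have "(4::nat) * 2 ^ n < 5 * 2 ^ n" by simp
    also have "\<dots> \<le> 2 ^ j * 32" using * le by simp
    finally have "(2::nat) ^ (n + 2) < 2 ^ (j + 5)" by (simp add: power_add)
    then have "n + 2 < j + 5" by (rule power_less_imp_less_exp[rotated]) simp
    moreover have "r \<noteq> 0" by (rule nonchain) (use * pos in linarith)
    ultimately have r: "r = 1" using n by simp
    have "k * 32 = 5 * (4 * 2 ^ j)" using * n r by simp
    then have "k \<noteq> 2 ^ j" "\<not> 2 * k < 2 ^ j" by auto
    then show ?thesis using r1[OF r] n r by simp
  qed
  have 4: "n \<ge> 6 \<and> Con L \<cong>\<^sub>l \<L>\<^sub>2 [^]\<^sub>l (n - 3)" if *: "k * 8 = 2 ^ n"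
  proof -
    have "(2::nat) ^ n \<le> 2 ^ (j + 3)" using * le by (simp add: power_add del: power_increasing_iff)
    then have "n \<le> j + 3" by (rule power_le_imp_le_exp[rotated]) simp
    moreover have "r \<noteq> 0" by (rule nonchain) (use * pos in linarith)
    moreover have "r \<noteq> 1"
    proof
      assume r: "r = 1"
      then have half: "2 * k = 2 ^ j" using * n by simp
      then have "k = 5 * 2 ^ (j - 3) \<and> j \<ge> 3" using r1[OF r] by auto
      then obtain i where "k = 5 * 2 ^ i" "j = i + 3" by (metis le_add_diff_inverse2)
      then show False using half by (simp add: power_add)
    qed
    ultimately have r: "r = 2" using n by simp
    then show ?thesis using Boolean n6 * n by simp
  qed
  have "(of_nat k = (2::rat) powi (int n - 1)) = (k * 2 = 2 ^ n)"
    "(of_nat k = (2::rat) powi (int n - 2)) = (k * 4 = 2 ^ n)"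
    "(of_nat k = 5 * (2::rat) powi (int n - 5)) = (k * 32 = 5 * 2 ^ n)"
    "(of_nat k = (2::rat) powi (int n - 3)) = (k * 8 = 2 ^ n)"
    using of_nat_eq_powi_iff[of k 1 n 1] of_nat_eq_powi_iff[of k 1 n 2]
      of_nat_eq_powi_iff[of k 5 n 5] of_nat_eq_powi_iff[of k 1 n 3] by simp_all
  then show ?thesis using 1 2 3 4 unfolding k_def by blast
qed

end
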